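(* Let $x_0=0$ and let $\{x_n\}_{n\in\mathbb{N}}$ be a strictly increasing sequence of positive numbers with $\lim_{n\to+\infty}x_n=+\infty$ and $\inf_{n\in\mathbb{N}}(x_n-x_{n-1})>1$. Let $C$ be the comb domain \[C=\{z\in\mathbb{C}:\mathrm{Re}\, z>-x_1\}\setminus\bigcup_{n\in\mathbb{N}\cup\{0\}}\{x_n+iy: y\in\mathbb{R},\ |y|\ge 1\},\] and set $\alpha_n=x_n-x_{n-1}$ for $n\in\mathbb{N}$. If $\alpha_n$ is comparable to $e^{e^n}$, i.e. there are constants $c_1,c_2>0$ such that $c_1e^{e^n}\le\alpha_n\le c_2e^{e^n}$ for every $n\in\mathbb{N}$, then ${\rm h}(C)<+\infty$.
   Context: $\mathbb{N}=\{1,2,3,\dots\}$ and $\mathbb{D}$ is the open unit disk in $\mathbb{C}$. For $p>0$, the Hardy space $H^p(\mathbb{D})$ is the set of all holomorphic functions $f$ on $\mathbb{D}$ with $\sup_{0<r<1}\int_0^{2\pi}|f(re^{i\theta})|^p\,d\theta<+\infty$. If $D\ne\mathbb{C}$ is a simply connected domain and $f$ is a Riemann mapping (conformal bijection) from $\mathbb{D}$ onto $D$, the Hardy number of $D$ is ${\rm h}(D)=\sup\{p>0: f\in H^p(\mathbb{D})\}\in[1/2,+\infty]$; it does not depend on the choice of $f$. *)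

theory Defs
  imports "HOL-Complex_Analysis.Complex_Analysis"
begin

text \<open>For a function holomorphic on the disk the integrand is continuous in the angle, so the
  integral below is a genuine one; the finiteness of the supremum is boundedness from above.\<close>

definition hardy_space :: "real \<Rightarrow> (complex \<Rightarrow> complex) set" where
  "hardy_space p =
     {f. f holomorphic_on ball 0 1 \<and>
         bdd_above ((\<lambda>r. integral {0..2 * pi} (\<lambda>\<theta>. norm (f (of_real r * cis \<theta>)) powr p))
                      ` {0<..<1})}"

definition riemann_mapping :: "(complex \<Rightarrow> complex) \<Rightarrow> complex set \<Rightarrow> bool" where
  "riemann_mapping f D \<longleftrightarrow> f holomorphic_on ball 0 1 \<and> bij_betw f (ball 0 1) D"

text \<open>Meant for a simply connected domain \<open>D \<noteq> UNIV\<close>, where a Riemann mapping exists and the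
  value does not depend on the one chosen.\<close>

definition hardy_number :: "complex set \<Rightarrow> ennreal" where
  "hardy_number D =
     (let f = (SOME f. riemann_mapping f D)
      in Sup {ennreal p | p. p > 0 \<and> f \<in> hardy_space p})"

definition comb_domain :: "(nat \<Rightarrow> real) \<Rightarrow> complex set" where
  "comb_domain x =
     {z. Re z > - x 1} - (\<Union>n. {Complex (x n) y | y. \<bar>y\<bar> \<ge> 1})"

end

theory Submission
  imports Defs
begin

text \<open>Let \<open>f\<close> map the disk onto the comb domain with inverse \<open>g\<close>, and put \<open>u = 1 - \<bar>g\<bar>\<close>.
  If \<open>f\<close> lies in \<open>H\<^sup>p\<close> and \<open>m \<le> p\<close> is an integer, Cauchy's formula for \<open>f ^ m\<close> shows that
  \<open>\<bar>w\<bar> ^ m * u w\<close> is bounded on the comb domain. On the other hand, the comb domain contains the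
  disks of radius 1 about the points \<open>x\<^sub>n\<close> and the largest disk in each chamber centred on the real
  axis. Schwarz-Pick along this chain of disks gives \<open>u x\<^sub>n\<^sub>+\<^sub>1 \<ge> u x\<^sub>n / (64 \<alpha>\<^sup>2)\<close> with
  \<open>\<alpha> = x\<^sub>n\<^sub>+\<^sub>1 - x\<^sub>n\<close>, hence \<open>u x\<^sub>n \<ge> c * exp (- 2 * K * exp n)\<close> for some \<open>K\<close>. As \<open>x\<^sub>n\<close> is at
  least of order \<open>exp (exp n)\<close>, the number \<open>m\<close> cannot exceed \<open>2 * K\<close>.\<close>

section \<open>Growth of functions in Hardy spaces\<close>

text \<open>Passes from the real exponent \<open>p\<close> to an integer one, for which
  \<open>f ^ m\<close> is holomorphic and Cauchy's formula applies. The summand 1 covers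
  \<open>t \<le> 1\<close>.\<close>

lemma power_le_one_plus_powr:
  fixes t p :: real
  assumes "t \<ge> 0" "real m \<le> p"
  shows "t ^ m \<le> 1 + t powr p"
proof (cases "t \<le> 1")
  case True
  then have "t ^ m \<le> 1"
    using assms by (simp add: power_le_one)
  then show ?thesis
    by (smt (verit) powr_ge_zero)
next
  case False
  then have "t ^ m = t powr real m"
    by (simp add: powr_realpow)
  also have "\<dots> \<le> t powr p"
    using False assms by (intro powr_mono) auto
  finally show ?thesis by simp
qed

text \<open>Cauchy's formula for \<open>f ^ m\<close> on a circle of radius \<open>r\<close> around
  0 bounds the value at \<open>z\<close> by the mean of \<open>norm f ^ m\<close>, controlled by the
  Hardy norm, times the kernel bound \<open>1 / (r - norm z)\<close>.\<close>

lemma hardy_space_growth: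
  assumes f: "f \<in> hardy_space p" and "p > 0" "real m \<le> p"
  obtains A where "\<And>z. z \<in> ball 0 1 \<Longrightarrow> norm (f z) ^ m * (1 - norm z) \<le> A"
proof -
  have holf: "f holomorphic_on ball 0 1"
    using f by (simp add: hardy_space_def)
  obtain B where B: "\<And>r. \<lbrakk>0 < r; r < 1\<rbrakk> \<Longrightarrow>
      integral {0..2 * pi} (\<lambda>\<theta>. norm (f (of_real r * cis \<theta>)) powr p) \<le> B"
  proof -
    obtain M where "\<forall>y \<in> (\<lambda>r. integral {0..2 * pi} (\<lambda>\<theta>. norm (f (of_real r * cis \<theta>)) powr p))
        ` {0<..<1}. y \<le> M"
      using f unfolding hardy_space_def bdd_above_def by blast
    then show thesis
      by (intro that[of M]) auto
  qed
  have "norm (f z) ^ m * (1 - norm z) \<le> (2 * pi + B) / pi" if z: "z \<in> ball 0 1" for z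
  proof -
    \<comment> \<open>The midpoint between \<open>norm z\<close> and 1 makes the kernel bound
      \<open>2 / (1 - norm z)\<close>.\<close>
    define r where "r = (1 + norm z) / 2"
    have r: "0 < r" "r < 1" "norm z < r" "r - norm z = (1 - norm z) / 2"
      using z by (auto simp: r_def field_simps) (smt (verit) norm_ge_zero)
    have on_circle: "of_real r * cis t \<in> ball 0 1" for t
      using r by (simp add: norm_mult)
    have contf: "continuous_on {0..2 * pi} (\<lambda>t. f (of_real r * cis t))"
      by (rule continuous_on_compose2[OF holomorphic_on_imp_continuous_on[OF holf]])
         (use on_circle in \<open>auto intro!: continuous_intros\<close>)
    \<comment> \<open>The Cauchy integrand pulled back along \<open>r * cis t\<close>, derivative
      included.\<close>
    define G where "G = (\<lambda>t. f (of_real r * cis t) ^ m / (of_real r * cis t - z) * r * \<i> * cis t)"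
    have "((\<lambda>u. f u ^ m / (u - z)) has_contour_integral (2 * of_real pi * \<i> * f z ^ m)) (circlepath 0 r)"
    proof (rule Cauchy_integral_circlepath)
      show "continuous_on (cball 0 r) (\<lambda>u. f u ^ m)"
        using r by (intro continuous_intros holomorphic_on_imp_continuous_on
            holomorphic_on_subset[OF holf]) auto
      show "(\<lambda>u. f u ^ m) holomorphic_on ball 0 r"
        using r by (intro holomorphic_intros holomorphic_on_subset[OF holf]) auto
    qed (use r in auto)
    then have G: "(G has_integral (2 * of_real pi * \<i> * f z ^ m)) {0..2 * pi}"
      by (simp add: circlepath_def has_contour_integral_part_circlepath_iff G_def)
    define P where "P = (\<lambda>t. norm (f (of_real r * cis t)) powr p)"
    have intP: "P integrable_on {0..2 * pi}"
      unfolding P_def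
      by (intro integrable_continuous_real continuous_on_powr' continuous_intros contf)
         (use \<open>p > 0\<close> in auto)
    have bound: "norm (G t) \<le> (1 + P t) / (r - norm z)" for t
    proof -
      have "r - norm z \<le> norm (of_real r * cis t - z)"
        using norm_triangle_ineq2[of "of_real r * cis t" z] r by (simp add: norm_mult)
      moreover have "norm (f (of_real r * cis t)) ^ m * r \<le> (1 + P t) * 1"
        unfolding P_def using r assms
        by (intro mult_mono power_le_one_plus_powr) (auto simp: add_nonneg_nonneg)
      ultimately have "norm (f (of_real r * cis t)) ^ m * r / norm (of_real r * cis t - z)
          \<le> (1 + P t) / (r - norm z)"
        using r by (intro frac_le) (auto simp: P_def add_nonneg_nonneg)
      then show ?thesis
        using r(1) by (simp add: G_def norm_mult norm_divide norm_power)
    qed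
    have "((\<lambda>t. (1 + P t) / (r - norm z)) has_integral
        (2 * pi + integral {0..2 * pi} P) / (r - norm z)) {0..2 * pi}"
      using has_integral_add[OF has_integral_const_real[of 1 0 "2 * pi"] integrable_integral[OF intP]]
      by (intro has_integral_divide) simp
    then have "norm (2 * of_real pi * \<i> * f z ^ m) \<le> (2 * pi + integral {0..2 * pi} P) / (r - norm z)"
      using G bound
      by (metis (no_types, lifting) has_integral_integrable integral_norm_bound_integral integral_unique)
    also have "\<dots> \<le> (2 * pi + B) / (r - norm z)"
      using B[of r] r by (intro divide_right_mono) (auto simp: P_def)
    finally have "2 * pi * norm (f z) ^ m \<le> (2 * pi + B) / ((1 - norm z) / 2)"
      using r(4) by (simp add: norm_mult norm_power)
    then have "2 * pi * norm (f z) ^ m * ((1 - norm z) / 2) \<le> 2 * pi + B"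
      using z by (subst (asm) pos_le_divide_eq) auto
    then show ?thesis
      by (subst pos_le_divide_eq) (auto simp: mult_ac)
  qed
  then show thesis
    using that by blast
qed

section \<open>The Schwarz-Pick inequality on disks\<close>

text \<open>This is the symmetry of the pseudohyperbolic distance: the two denominators are complex
  conjugates.\<close>

lemma Moebius_function_norm_commute: "norm (Moebius_function 0 b c) = norm (Moebius_function 0 c b)"
proof -
  have "norm (1 - cnj c * b) = norm (cnj (1 - cnj c * b))"
    by (rule complex_mod_cnj[symmetric])
  then show ?thesis
    by (simp add: Moebius_function_simple norm_divide norm_minus_commute mult.commute)
qed

text \<open>With \<open>v\<close> the Moebius image of \<open>c\<close>, the quotient of
  \<open>(1 - (norm b)\<^sup>2) * (1 - (norm v)\<^sup>2)\<close> by
  \<open>(norm (1 + cnj b * v))\<^sup>2\<close> equals \<open>1 - (norm c)\<^sup>2\<close>. Bounding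
  the denominator by \<open>(1 + norm b) * (1 + norm v)\<close> leaves
  \<open>(1 - norm b) * (1 - norm v)\<close>.\<close>

lemma Moebius_function_norm_le_imp:
  assumes "norm b < 1" "norm c < 1" "norm (Moebius_function 0 b c) \<le> \<rho>" "\<rho> \<le> 1"
  shows "(1 - \<rho>) * (1 - norm b) \<le> 2 * (1 - norm c)"
proof -
  define v where "v = Moebius_function 0 b c"
  have v: "norm v < 1" "norm v \<le> \<rho>"
    using assms Moebius_function_norm_lt_1 by (auto simp: v_def)
  have "Moebius_function 0 (- b) v = c"
    unfolding v_def using assms by (intro Moebius_function_compose) auto
  moreover have "1 + cnj b * v \<noteq> 0"
  proof
    assume "1 + cnj b * v = 0"
    then have "norm (cnj b * v) = norm (- 1 :: complex)"
      by (metis add.inverse_inverse add_eq_0_iff)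
    then show False
      using norm_mult_less[of "cnj b" 1 v 1] assms v by simp
  qed
  ultimately have eq: "c * (1 + cnj b * v) = v + b"
    by (auto simp: Moebius_function_simple field_simps)
  define D where "D = norm (1 + cnj b * v)"
  have "norm (v + b) = norm c * D"
    unfolding eq[symmetric] D_def by (rule norm_mult)
  then have "D\<^sup>2 * (1 - (norm c)\<^sup>2) = D\<^sup>2 - (norm (v + b))\<^sup>2"
    by (simp add: power_mult_distrib algebra_simps)
  also have "\<dots> = (1 - (norm b)\<^sup>2) * (1 - (norm v)\<^sup>2)"
    unfolding D_def cmod_power2 by (simp add: power2_eq_square algebra_simps)
  finally have key: "D\<^sup>2 * (1 - (norm c)\<^sup>2) = (1 - (norm b)\<^sup>2) * (1 - (norm v)\<^sup>2)" .
  have "D > 0"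
    unfolding D_def using \<open>1 + cnj b * v \<noteq> 0\<close> by simp
  have "D \<le> 1 + norm b * norm v"
    unfolding D_def using norm_triangle_ineq[of 1 "cnj b * v"] by (simp add: norm_mult)
  then have "D\<^sup>2 \<le> (1 + norm b * norm v)\<^sup>2"
    using \<open>D > 0\<close> by (intro power_mono) auto
  \<comment> \<open>After expansion, each of the three products below absorbs one term of the
    square.\<close>
  also have "\<dots> \<le> (1 + norm b) * (1 + norm v)"
  proof -
    have "norm b * norm v \<le> norm b" "norm b * norm v \<le> norm v"
      "(norm b * norm v) * (norm b * norm v) \<le> norm b * norm v"
      using assms(1) v(1) by (auto intro!: mult_left_le mult_left_le_one_le mult_le_one)
    then show ?thesis
      by (simp add: power2_eq_square algebra_simps)
  qed
  finally have "D\<^sup>2 * ((1 - norm b) * (1 - norm v))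
      \<le> (1 + norm b) * (1 + norm v) * ((1 - norm b) * (1 - norm v))"
    using assms(1) v(1) by (intro mult_right_mono) auto
  also have "\<dots> = D\<^sup>2 * (1 - (norm c)\<^sup>2)"
    unfolding key by (simp add: power2_eq_square algebra_simps)
  finally have "(1 - norm b) * (1 - norm v) \<le> 1 - (norm c)\<^sup>2"
    using \<open>D > 0\<close> by simp
  moreover have "1 - (norm c)\<^sup>2 \<le> 2 * (1 - norm c)"
    using zero_le_power2[of "1 - norm c"] by (simp add: power2_eq_square algebra_simps)
  moreover have "(1 - \<rho>) * (1 - norm b) \<le> (1 - norm b) * (1 - norm v)"
    using assms(1) v(2) by (subst mult.commute) (intro mult_left_mono, auto)
  ultimately show ?thesis by linarith
qed

text \<open>The Schwarz lemma applies once the ball is rescaled to the unit disk and a Moebius map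
  moves \<open>g a\<close> to 0.\<close>

lemma Schwarz_Pick_ball:
  assumes holg: "g holomorphic_on ball a r" and g: "g ` ball a r \<subseteq> ball 0 1" and w: "w \<in> ball a r"
  shows "norm (Moebius_function 0 (g a) (g w)) \<le> dist a w / r"
proof -
  have r: "r > 0"
    using w by (smt (verit) mem_ball zero_le_dist)
  have ga: "norm (g a) < 1"
    using g r by (auto simp: image_subset_iff)
  have into: "a + of_real r * z \<in> ball a r" if "norm z < 1" for z
    using that r by (simp add: dist_norm norm_mult)
  define h where "h = Moebius_function 0 (g a) \<circ> (g \<circ> (\<lambda>z. a + of_real r * z))"
  have "g \<circ> (\<lambda>z. a + of_real r * z) holomorphic_on ball 0 1"
    using into by (intro holomorphic_on_compose_gen[OF _ holg] holomorphic_intros) auto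
  then have "h holomorphic_on ball 0 1"
    unfolding h_def using g into
    by (intro holomorphic_on_compose_gen[OF _ Moebius_function_holomorphic[OF ga]])
       (auto simp: image_subset_iff)
  moreover have "h 0 = 0"
    by (simp add: h_def Moebius_function_eq_zero)
  moreover have "norm (h z) < 1" if "norm z < 1" for z
    using g ga into[OF that] by (auto simp: h_def image_subset_iff intro!: Moebius_function_norm_lt_1)
  moreover have "norm ((w - a) / of_real r) < 1"
    using w r by (simp add: norm_divide dist_norm norm_minus_commute)
  ultimately have "norm (h ((w - a) / of_real r)) \<le> norm ((w - a) / of_real r)"
    by (rule Schwarz_Lemma)
  then show ?thesis
    using r by (simp add: h_def norm_divide dist_norm norm_minus_commute)
qed

text \<open>A Harnack-type comparison of \<open>1 - norm g\<close> at the centre and at another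
  point. Both directions hold because the pseudohyperbolic distance is symmetric.\<close>

corollary boundary_distance_ball:
  assumes "g holomorphic_on ball a r" "g ` ball a r \<subseteq> ball 0 1" "w \<in> ball a r"
  shows "(1 - dist a w / r) * (1 - norm (g a)) \<le> 2 * (1 - norm (g w))"
    and "(1 - dist a w / r) * (1 - norm (g w)) \<le> 2 * (1 - norm (g a))"
proof -
  have "r > 0"
    using assms(3) by (smt (verit) mem_ball zero_le_dist)
  then have "norm (g a) < 1" "norm (g w) < 1" "dist a w / r \<le> 1"
    using assms by (auto simp: image_subset_iff)
  with Schwarz_Pick_ball[OF assms]
  show "(1 - dist a w / r) * (1 - norm (g a)) \<le> 2 * (1 - norm (g w))"
    and "(1 - dist a w / r) * (1 - norm (g w)) \<le> 2 * (1 - norm (g a))"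
    by (simp_all only: Moebius_function_norm_le_imp Moebius_function_norm_commute[of "g w" "g a"])
qed

section \<open>The comb domain\<close>

lemma mem_comb_domain_iff:
  "z \<in> comb_domain x \<longleftrightarrow> Re z > - x 1 \<and> (Re z \<notin> range x \<or> \<bar>Im z\<bar> < 1)"
  by (cases z) (force simp: comb_domain_def)

context
  fixes x :: "nat \<Rightarrow> real"
  assumes x0: "x 0 = 0" and gap: "\<And>n. x n + 1 < x (Suc n)"
begin

lemma comb_gap: "m < n \<Longrightarrow> x m + 1 < x n"
proof (induction n)
  case (Suc n)
  then show ?case
    using gap[of n] by (cases "m = n") auto
qed simp

lemma comb_nonneg: "x n \<ge> 0"
  using comb_gap[of 0 n] x0 by (cases n) auto

text \<open>The nodes are 1-separated, so \<open>range x\<close> is closed, and off the slits either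
  the real part avoids this closed set or the point lies in the open strip of height 2.\<close>

lemma open_comb_domain: "open (comb_domain x)"
proof -
  have "closed (range x)"
  proof (rule discrete_imp_closed[of 1])
    show "\<forall>s\<in>range x. \<forall>t\<in>range x. dist t s < 1 \<longrightarrow> t = s"
    proof safe
      fix m n assume "dist (x m) (x n) < 1"
      then show "x m = x n"
        using comb_gap[of m n] comb_gap[of n m] by (cases m n rule: linorder_cases) (auto simp: dist_real_def)
    qed
  qed simp
  moreover have "comb_domain x = {z. Re z > - x 1} \<inter> (Re -` (- range x) \<union> {z. \<bar>Im z\<bar> < 1})"
    by (auto simp: mem_comb_domain_iff)
  ultimately show ?thesis
    by (auto intro!: open_Int open_Un open_Collect_less continuous_intros open_vimage)
qed

lemma real_segment_subset_comb_domain: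
  "{z. Re z > - x 1 \<and> Im z = 0} \<subseteq> comb_domain x"
  by (auto simp: mem_comb_domain_iff)

text \<open>Collapse vertically onto the real axis, then to the origin.\<close>

lemma contractible_comb_domain: "contractible (comb_domain x)"
proof -
  let ?C = "comb_domain x" and ?R = "\<lambda>z. complex_of_real (Re z)"
  have "homotopic_with_canon (\<lambda>h. True) ?C ?C id ?R"
  proof (rule homotopic_with_linear)
    fix z assume z: "z \<in> ?C"
    show "closed_segment (id z) (?R z) \<subseteq> ?C"
    proof
      fix w assume "w \<in> closed_segment (id z) (?R z)"
      then obtain s where s: "0 \<le> s" "s \<le> 1" "w = (1 - s) *\<^sub>R z + s *\<^sub>R ?R z"
        unfolding in_segment by auto
      then have w: "Re w = Re z" "Im w = (1 - s) * Im z"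
        by (auto simp: left_diff_distrib)
      then have "\<bar>Im w\<bar> \<le> \<bar>Im z\<bar>"
        using s by (simp add: abs_mult mult_left_le_one_le)
      then show "w \<in> ?C"
        using z w(1) unfolding mem_comb_domain_iff by auto
    qed
  qed (auto intro!: continuous_intros)
  moreover have "homotopic_with_canon (\<lambda>h. True) ?C ?C ?R (\<lambda>z. 0)"
  proof (rule homotopic_with_linear)
    fix z assume z: "z \<in> ?C"
    have "convex {z. Re z > - x 1 \<and> Im z = 0}"
      using convex_Int[OF convex_halfspace_Re_gt[of "- x 1"] convex_hyperplane[of \<i> 0]]
      by (simp add: Int_def inner_complex_def)
    then have "closed_segment (?R z) 0 \<subseteq> {z. Re z > - x 1 \<and> Im z = 0}"
      using z comb_gap[of 0 1] x0 by (intro closed_segment_subset) (auto simp: mem_comb_domain_iff)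
    then show "closed_segment (?R z) 0 \<subseteq> ?C"
      using real_segment_subset_comb_domain by blast
  qed (auto intro!: continuous_intros)
  ultimately show ?thesis
    unfolding contractible_def using homotopic_with_trans by blast
qed

lemma riemann_mapping_comb_domain: "\<exists>f. riemann_mapping f (comb_domain x)"
proof -
  \<comment> \<open>The two points show that the domain is neither empty nor the whole
    plane.\<close>
  have "complex_of_real (x 0) \<in> comb_domain x" "complex_of_real (- x 1) \<notin> comb_domain x"
    using comb_gap[of 0 1] x0 by (auto simp: mem_comb_domain_iff)
  moreover have "simply_connected (comb_domain x)"
    by (intro contractible_imp_simply_connected contractible_comb_domain)
  ultimately obtain f g where
    "g holomorphic_on ball 0 1" and fg: "\<forall>z \<in> comb_domain x. f z \<in> ball 0 1 \<and> g (f z) = z"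
    "\<forall>z \<in> ball 0 1. g z \<in> comb_domain x \<and> f (g z) = z"
    using open_comb_domain by (subst (asm) simply_connected_eq_biholomorphic_to_disc) auto
  then have "riemann_mapping g (comb_domain x)"
    unfolding riemann_mapping_def
    by (intro conjI bij_betw_byWitness[where f' = f]) auto
  then show ?thesis by blast
qed

section \<open>Disks in the comb domain and the boundary distance at the nodes\<close>

lemma ball_node_subset_comb_domain: "ball (complex_of_real (x n)) 1 \<subseteq> comb_domain x"
proof
  fix z assume "z \<in> ball (complex_of_real (x n)) 1"
  then have z: "\<bar>Re z - x n\<bar> < 1" "\<bar>Im z\<bar> < 1"
    using abs_Re_le_cmod[of "z - x n"] abs_Im_le_cmod[of "z - x n"]
    by (auto simp: dist_norm norm_minus_commute)
  \<comment> \<open>Since \<open>x 1 > 1\<close>, even the disk about \<open>x 0 = 0\<close> stays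
    to the right of the edge \<open>Re z = - x 1\<close>.\<close>
  then show "z \<in> comb_domain x"
    using comb_gap[of 0 1] x0 comb_nonneg[of n] by (auto simp: mem_comb_domain_iff)
qed

lemma ball_chamber_subset_comb_domain:
  "ball (complex_of_real ((x n + x (Suc n)) / 2)) ((x (Suc n) - x n) / 2) \<subseteq> comb_domain x"
proof
  fix z assume "z \<in> ball (complex_of_real ((x n + x (Suc n)) / 2)) ((x (Suc n) - x n) / 2)"
  then have "\<bar>Re z - (x n + x (Suc n)) / 2\<bar> < (x (Suc n) - x n) / 2"
    using abs_Re_le_cmod[of "z - complex_of_real ((x n + x (Suc n)) / 2)"]
    by (simp add: dist_norm norm_minus_commute)
  then have z: "x n < Re z" "Re z < x (Suc n)"
    by (auto simp: abs_if field_simps split: if_splits)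
  have "Re z \<noteq> x k" for k
    using comb_gap[of k n] comb_gap[of "Suc n" k] z
    by (cases "k < n"; cases "k = n"; cases "k = Suc n") auto
  moreover have "Re z > - x 1"
    using z comb_nonneg[of n] comb_nonneg[of 1] by linarith
  ultimately show "z \<in> comb_domain x"
    by (auto simp: mem_comb_domain_iff)
qed

text \<open>The chain runs from \<open>x n\<close> over \<open>x n + 1 / 2\<close>, the chamber
  centre \<open>c\<close> and \<open>x (Suc n) - 1 / 2\<close> to \<open>x (Suc n)\<close>. Its
  links cost the factors 4, \<open>2 * \<alpha>\<close>, \<open>2 * \<alpha>\<close> and 4.\<close>

lemma boundary_distance_step:
  assumes holg: "g holomorphic_on comb_domain x" and g: "g ` comb_domain x \<subseteq> ball 0 1"
  shows "1 - norm (g (x n)) \<le> 64 * (x (Suc n) - x n)\<^sup>2 * (1 - norm (g (x (Suc n))))"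
proof -
  define u where "u = (\<lambda>t::real. 1 - norm (g (complex_of_real t)))"
  define \<alpha> where "\<alpha> = x (Suc n) - x n"
  define c where "c = (x n + x (Suc n)) / 2"
  have \<alpha>: "\<alpha> > 1"
    using gap[of n] by (simp add: \<alpha>_def)
  have on_ball: "(1 - \<bar>a - w\<bar> / r) * u a \<le> 2 * u w" "(1 - \<bar>a - w\<bar> / r) * u w \<le> 2 * u a"
    if "ball (complex_of_real a) r \<subseteq> comb_domain x" "\<bar>a - w\<bar> < r" for a w r :: real
  proof -
    have d: "dist (complex_of_real a) (complex_of_real w) = \<bar>a - w\<bar>"
      by (metis dist_norm norm_of_real of_real_diff)
    show "(1 - \<bar>a - w\<bar> / r) * u a \<le> 2 * u w" "(1 - \<bar>a - w\<bar> / r) * u w \<le> 2 * u a"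
      using boundary_distance_ball[OF holomorphic_on_subset[OF holg that(1)], of "of_real w"]
        that g unfolding u_def d[symmetric] by auto
  qed
  note chamber = ball_chamber_subset_comb_domain[of n, folded c_def \<alpha>_def]
  \<comment> \<open>The two intermediate points lie at distance 1/2 from the nodes, hence in both a
    node disk and the chamber disk. In the latter their relative depth is
    \<open>1 / \<alpha>\<close>.\<close>
  have ratio: "1 - (\<alpha> / 2 - 1 / 2) / (\<alpha> / 2) = 1 / \<alpha>"
    using \<alpha> by (simp add: field_simps)
  have 1: "u (x n) \<le> 4 * u (x n + 1 / 2)"
    using on_ball(1)[OF ball_node_subset_comb_domain[of n], of "x n + 1 / 2"] by simp
  have 2: "u (x n + 1 / 2) \<le> 2 * \<alpha> * u c"
  proof -
    have "\<bar>c - (x n + 1 / 2)\<bar> = \<alpha> / 2 - 1 / 2"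
      using \<alpha> by (simp add: c_def \<alpha>_def field_simps)
    then have "1 / \<alpha> * u (x n + 1 / 2) \<le> 2 * u c"
      using on_ball(2)[OF chamber, of "x n + 1 / 2"] by (simp only: ratio)
    then show ?thesis
      using \<alpha> by (simp add: field_simps)
  qed
  have 3: "u c \<le> 2 * \<alpha> * u (x (Suc n) - 1 / 2)"
  proof -
    have "\<bar>c - (x (Suc n) - 1 / 2)\<bar> = \<alpha> / 2 - 1 / 2"
      using \<alpha> by (simp add: c_def \<alpha>_def field_simps)
    then have "1 / \<alpha> * u c \<le> 2 * u (x (Suc n) - 1 / 2)"
      using on_ball(1)[OF chamber, of "x (Suc n) - 1 / 2"] by (simp only: ratio)
    then show ?thesis
      using \<alpha> by (simp add: field_simps)
  qed
  have 4: "u (x (Suc n) - 1 / 2) \<le> 4 * u (x (Suc n))"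
    using on_ball(2)[OF ball_node_subset_comb_domain[of "Suc n"], of "x (Suc n) - 1 / 2"] by simp
  note 1
  also have "4 * u (x n + 1 / 2) \<le> 4 * (2 * \<alpha> * u c)"
    using 2 by simp
  also have "\<dots> \<le> 4 * (2 * \<alpha> * (2 * \<alpha> * u (x (Suc n) - 1 / 2)))"
    using 3 \<alpha> by simp
  also have "\<dots> \<le> 4 * (2 * \<alpha> * (2 * \<alpha> * (4 * u (x (Suc n)))))"
    using 4 \<alpha> by simp
  also have "\<dots> = 64 * \<alpha>\<^sup>2 * u (x (Suc n))"
    by (simp add: power2_eq_square)
  finally show ?thesis
    by (simp only: u_def \<alpha>_def)
qed

text \<open>Iterating the step multiplies factors of at most \<open>exp (K * exp k)\<close> for
  \<open>k \<le> n\<close>. Their exponents form a geometric sum dominated by its last term, whence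
  the factor 2. In \<open>K\<close>, the 2 comes from squaring the gap, and the logarithm absorbs
  the constant.\<close>

lemma boundary_distance_node:
  assumes holg: "g holomorphic_on comb_domain x" and g: "g ` comb_domain x \<subseteq> ball 0 1"
    and c2: "c2 > 0" "\<And>n. x (Suc n) - x n \<le> c2 * exp (exp (real (Suc n)))"
    and K: "K = 2 + \<bar>ln (64 * c2\<^sup>2)\<bar>"
  shows "(1 - norm (g 0)) * exp (- 2 * K * exp (real n)) \<le> 1 - norm (g (x n))"
proof -
  have norm_less_1: "norm (g (x k)) < 1" for k
    using g ball_node_subset_comb_domain[of k] by (auto simp: image_subset_iff subset_iff)
  show ?thesis
  proof (induction n)
    case 0
    then show ?case
      using K norm_less_1[of 0] by (simp add: x0 mult_left_le)
  next
    case (Suc n)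
    let ?E = "exp (real (Suc n))" and ?u = "1 - norm (g (x (Suc n)))"
    have u: "?u \<ge> 0"
      using norm_less_1 by (simp add: less_imp_le)
    have "64 * (x (Suc n) - x n)\<^sup>2 \<le> 64 * (c2 * exp ?E)\<^sup>2"
      using c2(2)[of n] gap[of n] by (intro mult_left_mono power_mono) auto
    also have "\<dots> = exp (ln (64 * c2\<^sup>2) + 2 * ?E)"
      using c2 by (simp add: exp_add power_mult_distrib exp_double)
    also have "\<dots> \<le> exp (K * ?E)"
    proof -
      have "ln (64 * c2\<^sup>2) * 1 \<le> \<bar>ln (64 * c2\<^sup>2)\<bar> * ?E"
        by (intro mult_mono) auto
      then show ?thesis
        by (simp add: K algebra_simps)
    qed
    finally have step: "64 * (x (Suc n) - x n)\<^sup>2 \<le> exp (K * ?E)" .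
    \<comment> \<open>From \<open>exp 1 \<ge> 2\<close>: the accumulated exponent
      \<open>2 * K * exp n\<close> plus the new \<open>K * exp (n + 1)\<close> stays below
      \<open>2 * K * exp (n + 1)\<close>.\<close>
    have "2 * exp (real n) \<le> ?E"
      using exp_ge_add_one_self[of 1] by (simp add: exp_add)
    then have "K * (2 * exp (real n)) \<le> K * ?E"
      using K by (intro mult_left_mono) auto
    then have "exp (- 2 * K * ?E) \<le> exp (- 2 * K * exp (real n)) * exp (- K * ?E)"
      unfolding exp_add[symmetric] by simp
    then have "(1 - norm (g 0)) * exp (- 2 * K * ?E)
        \<le> (1 - norm (g 0)) * exp (- 2 * K * exp (real n)) * exp (- K * ?E)"
      using norm_less_1[of 0] x0 by (subst mult.assoc, intro mult_left_mono) auto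
    also have "\<dots> \<le> (1 - norm (g (x n))) * exp (- K * ?E)"
      using Suc by (intro mult_right_mono) auto
    also have "\<dots> \<le> 64 * (x (Suc n) - x n)\<^sup>2 * ?u * exp (- K * ?E)"
      by (intro mult_right_mono boundary_distance_step holg g) auto
    also have "\<dots> \<le> exp (K * ?E) * ?u * exp (- K * ?E)"
      using step u by (intro mult_right_mono) auto
    also have "\<dots> = ?u"
      by (simp add: exp_minus)
    finally show ?case .
  qed
qed

end

section \<open>Comparison of growth rates and finiteness of the Hardy number\<close>

lemma not_bdd_exp_exp:
  assumes "a > 0" "c > 0"
  shows "\<exists>n\<ge>1. c * exp (a * exp (real n)) > (A::real)"
proof -
  obtain k where "A / (c * a) < real k"
    using reals_Archimedean2 by blast
  then obtain n where n: "n \<ge> 1" "A / (c * a) < real n"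
    by (metis le_add1 lessI of_nat_less_iff order_less_trans plus_1_eq_Suc)
  have "A < c * (a * real n)"
    using n assms by (simp add: field_simps)
  also have "\<dots> \<le> c * (a * exp (real n))"
    using assms exp_ge_add_one_self[of "real n"] by (intro mult_left_mono) linarith+
  also have "\<dots> \<le> c * exp (a * exp (real n))"
    using assms exp_ge_add_one_self[of "a * exp (real n)"] by (intro mult_left_mono) linarith+
  finally show ?thesis
    using n by blast
qed

theorem theorem1p5:
  fixes x :: "nat \<Rightarrow> real"
  assumes x0: "x 0 = 0"
    and x_pos: "\<And>n. n \<ge> 1 \<Longrightarrow> x n > 0"
    and x_incr: "strict_mono_on {1..} x"
    and x_lim: "filterlim x at_top sequentially"
    and x_gap: "(INF n\<in>{1..}. x n - x (n - 1)) > 1"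
    and comparable: "\<exists>c1 c2 :: real. c1 > 0 \<and> c2 > 0 \<and>
      (\<forall>n\<ge>1. c1 * exp (exp (real n)) \<le> x n - x (n - 1) \<and>
              x n - x (n - 1) \<le> c2 * exp (exp (real n)))"
  shows "hardy_number (comb_domain x) < \<infinity>"
proof -
  \<comment> \<open>Monotonicity is given from index 1 on; the step from 0 to 1 comes from
    \<open>x 0 = 0 < x 1\<close>.\<close>
  have incr: "x n < x (Suc n)" for n
    using x_incr x_pos[of 1] x0 by (cases n) (auto simp: strict_mono_on_def)
  have "x n + 1 < x (Suc n)" for n
  proof -
    \<comment> \<open>A real infimum bounds its terms from below only once the family is known to be
      bounded below.\<close>
    have "bdd_below ((\<lambda>n. x n - x (n - 1)) ` {1..})"
    proof (rule bdd_belowI2)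
      fix n :: nat assume "n \<in> {1..}"
      then show "0 \<le> x n - x (n - 1)"
        using incr[of "n - 1"] by simp
    qed
    then have "(INF n\<in>{1..}. x n - x (n - 1)) \<le> x (Suc n) - x (Suc n - 1)"
      by (rule cINF_lower) simp
    with x_gap show ?thesis by simp
  qed
  note comb = x0 this
  obtain c1 c2 where c: "c1 > 0" "c2 > 0"
    and lower: "\<And>n. n \<ge> 1 \<Longrightarrow> c1 * exp (exp (real n)) \<le> x n - x (n - 1)"
    and upper: "\<And>n. n \<ge> 1 \<Longrightarrow> x n - x (n - 1) \<le> c2 * exp (exp (real n))"
    using comparable by blast
  \<comment> \<open>The very map selected by \<open>hardy_number\<close>, so that bounds for it
    transfer directly.\<close>
  define f where "f = (SOME f. riemann_mapping f (comb_domain x))"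
  have "riemann_mapping f (comb_domain x)"
    unfolding f_def by (rule someI_ex[OF riemann_mapping_comb_domain[OF comb]])
  then have holf: "f holomorphic_on ball 0 1" and bij: "bij_betw f (ball 0 1) (comb_domain x)"
    by (auto simp: riemann_mapping_def)
  obtain g where holg: "g holomorphic_on f ` ball 0 1" and gf: "\<And>z. z \<in> ball 0 1 \<Longrightarrow> g (f z) = z"
    using holomorphic_has_inverse[OF holf open_ball bij_betw_imp_inj_on[OF bij]] by metis
  have im: "f ` ball 0 1 = comb_domain x"
    using bij by (simp add: bij_betw_def)
  have g: "g w \<in> ball 0 1" "f (g w) = w" if "w \<in> comb_domain x" for w
    using that gf by (auto simp flip: im)
  have g_into: "g ` comb_domain x \<subseteq> ball 0 1"
    using g by blast
  have node: "complex_of_real (x n) \<in> comb_domain x" for n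
    using ball_node_subset_comb_domain[OF comb, of n] by auto
  define K where "K = 2 + \<bar>ln (64 * c2\<^sup>2)\<bar>"
  have u: "(1 - norm (g 0)) * exp (- 2 * K * exp (real n)) \<le> 1 - norm (g (x n))" for n
    using upper[of "Suc _"]
    by (intro boundary_distance_node[OF comb _ g_into c(2) _ K_def]) (use holg im in auto)
  have u0: "1 - norm (g 0) > 0"
    using g(1)[OF node[of 0]] x0 by simp
  have m_le: "real m \<le> 2 * K" if p: "f \<in> hardy_space p" "p > 0" "real m \<le> p" for m p
  proof (rule ccontr)
    assume m: "\<not> real m \<le> 2 * K"
    obtain A where A: "\<And>z. z \<in> ball 0 1 \<Longrightarrow> norm (f z) ^ m * (1 - norm z) \<le> A"
      using hardy_space_growth[OF p] by blast
    have le: "c1 ^ m * (1 - norm (g 0)) * exp ((real m - 2 * K) * exp (real n)) \<le> A"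
      if "n \<ge> 1" for n
    proof -
      \<comment> \<open>Separates the growth of \<open>x n ^ m\<close> from the decay of the
        boundary distance; a positive \<open>real m - 2 * K\<close> makes the growth win.\<close>
      have exp_eq: "exp ((real m - 2 * K) * exp (real n))
          = exp (exp (real n)) ^ m * exp (- 2 * K * exp (real n))"
        unfolding exp_of_nat_mult[symmetric] exp_add[symmetric] by (simp add: algebra_simps)
      \<comment> \<open>The last gap alone bounds \<open>x n\<close> from below, as the preceding
        node is nonnegative.\<close>
      have "c1 * exp (exp (real n)) \<le> x n"
        using lower[of n] comb_nonneg[OF comb, of "n - 1"] that by linarith
      then have "(c1 * exp (exp (real n))) ^ m \<le> x n ^ m"
        using c by (intro power_mono) auto
      then have "(c1 * exp (exp (real n))) ^ m * ((1 - norm (g 0)) * exp (- 2 * K * exp (real n)))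
          \<le> x n ^ m * (1 - norm (g (x n)))"
        using u0 c comb_nonneg[OF comb, of n] by (intro mult_mono u) auto
      also have "\<dots> \<le> A"
        using A[OF g(1)[OF node[of n]]] g(2)[OF node[of n]] comb_nonneg[OF comb, of n] by simp
      finally show ?thesis
        unfolding power_mult_distrib exp_eq by (simp only: mult_ac)
    qed
    show False
      using not_bdd_exp_exp[of "real m - 2 * K" "c1 ^ m * (1 - norm (g 0))"] le m u0 c
      by (meson linorder_not_less mult_pos_pos diff_gt_0_iff_gt zero_less_power)
  qed
  \<comment> \<open>Rounding \<open>p\<close> down to an integer loses less than 1.\<close>
  have "p \<le> 2 * K + 1" if "f \<in> hardy_space p" "p > 0" for p
    using m_le[OF that, of "nat \<lfloor>p\<rfloor>"] that by linarith
  then have "Sup {ennreal p | p. p > 0 \<and> f \<in> hardy_space p} \<le> ennreal (2 * K + 1)"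
    by (intro Sup_least) (auto intro: ennreal_leI)
  then show ?thesis
    unfolding hardy_number_def Let_def f_def[symmetric]
    by (simp add: order_le_less_trans)
qed

end
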